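(* Let $\varphi:\mathbb{D}\to\mathbb{D}$ be analytic with $\|\varphi\|_\infty<1$. Then for every $h\in\mathcal{H}^2$ the weighted composition operator $W_{h,\varphi}:f\mapsto h\cdot(f\circ\varphi)$ on $\mathcal{H}^2$ is trace-class, i.e. it lies in the Schatten class $S_1(\mathcal{H}^2)$.
   Context: $\mathbb{D}$ is the open unit disc in $\mathbb{C}$. $\mathcal{H}^2$ is the Hardy space of holomorphic $f$ on $\mathbb{D}$ with $\|f\|_2^2=\sup_{0\le r<1}\int_0^{2\pi}|f(re^{i\theta})|^2\,\frac{d\theta}{2\pi}<\infty$. $\|\varphi\|_\infty=\sup_{z\in\mathbb{D}}|\varphi(z)|$. $W_{h,\varphi}f(z)=h(z)f(\varphi(z))$. *)

theory Defs
  imports "HOL-Complex_Analysis.Complex_Analysis"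
begin

definition circle_mean_sq :: "(complex \<Rightarrow> complex) \<Rightarrow> real \<Rightarrow> real" where
  "circle_mean_sq f r = integral {0..2*pi} (\<lambda>\<theta>. (norm (f (rcis r \<theta>)))\<^sup>2) / (2*pi)"

text \<open>
  An element of the Hardy space is a function on the disc. It is represented by the total
  function that vanishes off the disc, so that HOL equality is equality in the Hardy space.
\<close>

definition hardy_space :: "(complex \<Rightarrow> complex) set" where
  "hardy_space = {f. f holomorphic_on ball 0 1 \<and>
                     bdd_above (circle_mean_sq f ` {0..<1}) \<and>
                     (\<forall>z. z \<notin> ball 0 1 \<longrightarrow> f z = 0)}"

definition hardy_norm :: "(complex \<Rightarrow> complex) \<Rightarrow> real" where
  "hardy_norm f = sqrt (SUP r\<in>{0..<1}. circle_mean_sq f r)"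

text \<open>
  The inner product inducing this norm: since the means increase with the radius, the supremum
  in the norm is the limit as the radius tends to 1.
\<close>

definition hardy_inner :: "(complex \<Rightarrow> complex) \<Rightarrow> (complex \<Rightarrow> complex) \<Rightarrow> complex" where
  "hardy_inner f g =
     Lim (at_left 1)
       (\<lambda>r::real. integral {0..2*pi} (\<lambda>\<theta>. f (rcis r \<theta>) * cnj (g (rcis r \<theta>))) / (2*pi))"

text \<open>
  Operators on the Hardy space are HOL functions of which only the values on
  \<^const>\<open>hardy_space\<close> matter.
\<close>

definition bounded_operator ::
    "((complex \<Rightarrow> complex) \<Rightarrow> (complex \<Rightarrow> complex)) \<Rightarrow> bool" where
  "bounded_operator T \<longleftrightarrow>
     (\<forall>f\<in>hardy_space. T f \<in> hardy_space) \<and>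
     (\<forall>f\<in>hardy_space. \<forall>g\<in>hardy_space. T (\<lambda>z. f z + g z) = (\<lambda>z. T f z + T g z)) \<and>
     (\<forall>c. \<forall>f\<in>hardy_space. T (\<lambda>z. c * f z) = (\<lambda>z. c * T f z)) \<and>
     (\<exists>C. \<forall>f\<in>hardy_space. hardy_norm (T f) \<le> C * hardy_norm f)"

definition is_adjoint ::
    "((complex \<Rightarrow> complex) \<Rightarrow> (complex \<Rightarrow> complex)) \<Rightarrow>
     ((complex \<Rightarrow> complex) \<Rightarrow> (complex \<Rightarrow> complex)) \<Rightarrow> bool" where
  "is_adjoint S T \<longleftrightarrow>
     bounded_operator S \<and>
     (\<forall>f\<in>hardy_space. \<forall>g\<in>hardy_space. hardy_inner (T f) g = hardy_inner f (S g))"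

definition positive_operator ::
    "((complex \<Rightarrow> complex) \<Rightarrow> (complex \<Rightarrow> complex)) \<Rightarrow> bool" where
  "positive_operator A \<longleftrightarrow>
     bounded_operator A \<and> (\<forall>f\<in>hardy_space. hardy_inner (A f) f \<in> \<real>\<^sub>\<ge>\<^sub>0)"

text \<open>\<open>A\<close> is the absolute value of \<open>T\<close>, i.e. the positive square root of \<open>T\<^sup>* T\<close>.\<close>

definition is_abs_operator ::
    "((complex \<Rightarrow> complex) \<Rightarrow> (complex \<Rightarrow> complex)) \<Rightarrow>
     ((complex \<Rightarrow> complex) \<Rightarrow> (complex \<Rightarrow> complex)) \<Rightarrow> bool" where
  "is_abs_operator A T \<longleftrightarrow>
     positive_operator A \<and>
     (\<exists>S. is_adjoint S T \<and> (\<forall>f\<in>hardy_space. A (A f) = S (T f)))"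

text \<open>Orthonormal bases in the Hilbert space sense: maximal orthonormal sets.\<close>

definition orthonormal_basis :: "(complex \<Rightarrow> complex) set \<Rightarrow> bool" where
  "orthonormal_basis B \<longleftrightarrow>
     B \<subseteq> hardy_space \<and>
     (\<forall>e\<in>B. \<forall>e'\<in>B. hardy_inner e e' = (if e = e' then 1 else 0)) \<and>
     (\<forall>f\<in>hardy_space. (\<forall>e\<in>B. hardy_inner f e = 0) \<longrightarrow> f = (\<lambda>z. 0))"

text \<open>
  The Schatten class of exponent 1: the absolute value has finite trace. The trace is the sum
  of a nonnegative family, which does not depend on the orthonormal basis.
\<close>

definition trace_class ::
    "((complex \<Rightarrow> complex) \<Rightarrow> (complex \<Rightarrow> complex)) set" where
  "trace_class = {T. bounded_operator T \<and>
     (\<exists>A. is_abs_operator A T \<and>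
          (\<forall>B. orthonormal_basis B \<longrightarrow> (\<lambda>e. Re (hardy_inner (A e) e)) summable_on B))}"

definition weighted_composition ::
    "(complex \<Rightarrow> complex) \<Rightarrow> (complex \<Rightarrow> complex) \<Rightarrow>
     (complex \<Rightarrow> complex) \<Rightarrow> (complex \<Rightarrow> complex)" where
  "weighted_composition h \<phi> f = (\<lambda>z. if z \<in> ball 0 1 then h z * f (\<phi> z) else 0)"

end

theory Submission
  imports Defs
begin

text \<open>
  Expanding \<open>f\<close> in monomials gives \<open>W f = (\<Sum>n. f\<^sub>n * h * \<phi>\<^sup>n)\<close>, where \<open>h * \<phi>\<^sup>n\<close> has norm at most
  \<open>\<parallel>h\<parallel> * \<rho>\<^sup>n\<close> with \<open>\<rho> = \<parallel>\<phi>\<parallel>\<^sub>\<infinity> < 1\<close>. So \<open>W\<close> is a norm convergent sum of rank one operators, which also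
  yields its adjoint. The absolute value \<open>A\<close> and a square root \<open>B\<close> of \<open>A\<close> come from the iteration
  \<open>Y \<mapsto> (X + Y\<^sup>2) / 2\<close> for a contraction \<open>X\<close>, whose limit satisfies \<open>(1 - Y)\<^sup>2 = 1 - X\<close>.
  For an orthonormal family \<open>e\<close>, the sum of the \<open>\<langle>A e, e\<rangle> = \<parallel>B e\<parallel>\<^sup>2\<close> is, by Parseval for the
  monomials \<open>z\<^sup>n\<close> and Bessel for \<open>e\<close>, bounded by a multiple of the sum of the
  \<open>\<parallel>B z\<^sup>n\<parallel>\<^sup>2 = \<langle>A z\<^sup>n, z\<^sup>n\<rangle> \<le> \<parallel>A z\<^sup>n\<parallel> = \<parallel>W z\<^sup>n\<parallel> = \<parallel>h * \<phi>\<^sup>n\<parallel>\<close>.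
\<close>

section \<open>Square roots of positive operators on a real Hilbert space\<close>

text \<open>Here \<open>p\<close> is the orthogonal projection of \<open>x\<close> onto the span of
  \<open>F\<close>, and the bound expresses that \<open>x - p\<close> has nonnegative square
  norm.\<close>

lemma Bessel_inequality:
  fixes x :: "'a::real_inner"
  assumes "finite F" and orth: "\<And>e e'. e \<in> F \<Longrightarrow> e' \<in> F \<Longrightarrow> e \<bullet> e' = (if e = e' then 1 else 0)"
  shows "(\<Sum>e\<in>F. (e \<bullet> x)\<^sup>2) \<le> (norm x)\<^sup>2"
proof -
  define p where "p = (\<Sum>e\<in>F. (e \<bullet> x) *\<^sub>R e)"
  have "p \<bullet> e = e \<bullet> x" if "e \<in> F" for e
    using \<open>finite F\<close> that by (simp add: p_def inner_sum_left orth if_distrib cong: if_cong)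
  then have "p \<bullet> p = (\<Sum>e\<in>F. (e \<bullet> x)\<^sup>2)"
    by (subst (2) p_def) (simp add: inner_sum_right power2_eq_square)
  moreover have "x \<bullet> p = (\<Sum>e\<in>F. (e \<bullet> x)\<^sup>2)"
    by (simp add: p_def inner_sum_right power2_eq_square inner_commute)
  moreover have "0 \<le> (x - p) \<bullet> (x - p)"
    by simp
  ultimately show ?thesis
    by (simp add: inner_diff_left inner_diff_right inner_commute power2_norm_eq_inner)
qed

text \<open>Complex linear operators are treated as real ones that commute with multiplication by i.
  For those, symmetry in the real inner product is complex self-adjointness.\<close>

definition selfadjoint :: "('a::real_inner \<Rightarrow>\<^sub>L 'a) \<Rightarrow> bool" where
  "selfadjoint X \<longleftrightarrow> (\<forall>x y. X x \<bullet> y = x \<bullet> X y)"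

lemma selfadjointD: "selfadjoint X \<Longrightarrow> X x \<bullet> y = x \<bullet> X y"
  by (simp add: selfadjoint_def)

lemma selfadjoint_0: "selfadjoint 0"
  by (simp add: selfadjoint_def)

lemma selfadjoint_id: "selfadjoint id_blinfun"
  by (simp add: selfadjoint_def)

lemma selfadjoint_add: "selfadjoint X \<Longrightarrow> selfadjoint Y \<Longrightarrow> selfadjoint (X + Y)"
  by (simp add: selfadjoint_def blinfun.add_left inner_add_left inner_add_right)

lemma selfadjoint_diff: "selfadjoint X \<Longrightarrow> selfadjoint Y \<Longrightarrow> selfadjoint (X - Y)"
  by (simp add: selfadjoint_def blinfun.diff_left inner_diff_left inner_diff_right)

lemma selfadjoint_scaleR: "selfadjoint X \<Longrightarrow> selfadjoint (c *\<^sub>R X)"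
  by (simp add: selfadjoint_def blinfun.scaleR_left)

lemma selfadjoint_square: "selfadjoint X \<Longrightarrow> selfadjoint (X o\<^sub>L X)"
  by (simp add: selfadjoint_def)

lemma LIMSEQ_selfadjoint:
  assumes "X \<longlonglongrightarrow> L" "\<And>n. selfadjoint (X n)"
  shows "selfadjoint L"
  unfolding selfadjoint_def
proof (intro allI)
  fix x y
  have "(\<lambda>n. X n x \<bullet> y) \<longlonglongrightarrow> L x \<bullet> y" "(\<lambda>n. x \<bullet> X n y) \<longlonglongrightarrow> x \<bullet> L y"
    by (intro tendsto_intros blinfun.tendsto assms(1))+
  then show "L x \<bullet> y = x \<bullet> L y"
    using assms(2) by (simp add: selfadjoint_def LIMSEQ_unique)
qed

section \<open>The square root iteration for contractions\<close>

primrec sqrt_iter :: "('a::real_normed_vector \<Rightarrow>\<^sub>L 'a) \<Rightarrow> nat \<Rightarrow> ('a \<Rightarrow>\<^sub>L 'a)" where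
  "sqrt_iter X 0 = 0"
| "sqrt_iter X (Suc n) = (1/2) *\<^sub>R (X + (sqrt_iter X n o\<^sub>L sqrt_iter X n))"

text \<open>This is the same iteration run on the number 1. It majorises the norms of the iterates,
  and of their increments, for every \<open>X\<close> in the closed unit ball.\<close>

primrec sqrt_bound :: "nat \<Rightarrow> real" where
  "sqrt_bound 0 = 0"
| "sqrt_bound (Suc n) = (1 + (sqrt_bound n)\<^sup>2) / 2"

lemma sqrt_bound_bounds: "0 \<le> sqrt_bound n \<and> sqrt_bound n \<le> 1"
proof (induction n)
  case (Suc n)
  then show ?case using power_le_one[of "sqrt_bound n" 2] by simp
qed simp

lemma norm_sqrt_iter:
  assumes "norm X \<le> 1"
  shows "norm (sqrt_iter X n) \<le> sqrt_bound n"
proof (induction n)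
  case (Suc n)
  have "norm (sqrt_iter X n o\<^sub>L sqrt_iter X n) \<le> (sqrt_bound n)\<^sup>2"
    unfolding power2_eq_square
    by (rule order_trans[OF norm_blinfun_compose mult_mono]) (use Suc sqrt_bound_bounds in auto)
  then have "norm (X + (sqrt_iter X n o\<^sub>L sqrt_iter X n)) \<le> 1 + (sqrt_bound n)\<^sup>2"
    using assms by norm
  then show ?case by simp
qed simp

text \<open>
  Splitting \<open>Y\<^sup>2 - Z\<^sup>2\<close> as \<open>Y (Y - Z) + (Y - Z) Z\<close> needs no commutativity and lets the scalar
  recursion dominate the increments.
\<close>

lemma norm_sqrt_iter_diff:
  assumes "norm X \<le> 1"
  shows "norm (sqrt_iter X (Suc n) - sqrt_iter X n) \<le> sqrt_bound (Suc n) - sqrt_bound n"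
proof (induction n)
  case 0
  then show ?case using assms by simp
next
  case (Suc n)
  define Y Z where "Y = sqrt_iter X (Suc n)" and "Z = sqrt_iter X n"
  define y z where "y = sqrt_bound (Suc n)" and "z = sqrt_bound n"
  have *: "norm Y \<le> y" "norm Z \<le> z" "norm (Y - Z) \<le> y - z" "0 \<le> z" "0 \<le> y"
    using norm_sqrt_iter[OF assms] Suc sqrt_bound_bounds unfolding Y_def Z_def y_def z_def by blast+
  moreover have "z \<le> y"
    using *(3) norm_ge_zero[of "Y - Z"] by linarith
  ultimately have "norm ((Y o\<^sub>L (Y - Z)) + ((Y - Z) o\<^sub>L Z)) \<le> y * (y - z) + (y - z) * z"
    by (intro norm_triangle_mono order_trans[OF norm_blinfun_compose] mult_mono)
       auto
  moreover have "(Y o\<^sub>L (Y - Z)) + ((Y - Z) o\<^sub>L Z) = (Y o\<^sub>L Y) - (Z o\<^sub>L Z)"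
    by (rule blinfun_eqI) (simp add: blinfun.bilinear_simps)
  ultimately have "norm ((Y o\<^sub>L Y) - (Z o\<^sub>L Z)) \<le> y\<^sup>2 - z\<^sup>2"
    by (simp add: algebra_simps power2_eq_square)
  moreover have "sqrt_iter X (Suc (Suc n)) - sqrt_iter X (Suc n)
      = (1/2) *\<^sub>R ((Y o\<^sub>L Y) - (Z o\<^sub>L Z))"
    unfolding Y_def Z_def by (subst (1 2) sqrt_iter.simps(2)) (simp add: algebra_simps)
  moreover have "sqrt_bound (Suc (Suc n)) - sqrt_bound (Suc n) = (y\<^sup>2 - z\<^sup>2) / 2"
    unfolding y_def z_def by (subst (1 2) sqrt_bound.simps(2)) (simp add: field_simps)
  ultimately show ?case by simp
qed

text \<open>On the closed unit ball the iterated map need not be a strict contraction, so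
  convergence is not drawn from a geometric rate. The increments are dominated by those of the
  bounded increasing \<open>sqrt_bound\<close>, whose sum telescopes.\<close>

lemma convergent_sqrt_iter:
  fixes X :: "'a::banach \<Rightarrow>\<^sub>L 'a"
  assumes "norm X \<le> 1"
  shows "convergent (sqrt_iter X)"
proof -
  \<comment> \<open>The increments of \<open>sqrt_bound\<close> dominate a norm, here for
    \<open>X = 0\<close>, and are therefore nonnegative.\<close>
  have "incseq sqrt_bound"
    using norm_sqrt_iter_diff[of 0] order_trans[OF norm_ge_zero]
    by (intro incseq_SucI) fastforce
  then have "convergent sqrt_bound"
    by (rule Bseq_mono_convergent[rotated, unfolded incseq_def[symmetric]])
       (use sqrt_bound_bounds in \<open>auto intro!: BseqI'[of _ 1] simp: incseq_def\<close>)
  then have "summable (\<lambda>n. sqrt_bound (Suc n) - sqrt_bound n)"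
    by (metis convergent_def telescope_sums sums_summable)
  then have "summable (\<lambda>n. sqrt_iter X (Suc n) - sqrt_iter X n)"
    by (rule summable_comparison_test'[of _ 0]) (use norm_sqrt_iter_diff[OF assms] in blast)
  then have "convergent (\<lambda>n. \<Sum>k<n. sqrt_iter X (Suc k) - sqrt_iter X k)"
    by (simp add: summable_iff_convergent)
  then show ?thesis
    by (simp only: sum_lessThan_telescope sqrt_iter.simps(1) diff_zero)
qed

text \<open>All iterates are polynomials in \<open>X\<close>, so symmetry and commutation with
  \<open>J\<close> hold for them and survive the norm limit. The clause on \<open>J\<close> later
  yields complex linearity, with \<open>J\<close> the multiplication by i.\<close>

lemma sqrt_fixpoint:
  fixes X :: "'a::{real_inner,banach} \<Rightarrow>\<^sub>L 'a"
  assumes X: "norm X \<le> 1" and sa: "selfadjoint X"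
  obtains Y where "norm Y \<le> 1" "selfadjoint Y"
    "(id_blinfun - Y) o\<^sub>L (id_blinfun - Y) = id_blinfun - X"
    "\<And>J. X o\<^sub>L J = J o\<^sub>L X \<Longrightarrow> Y o\<^sub>L J = J o\<^sub>L Y"
proof -
  obtain Y where Y: "sqrt_iter X \<longlonglongrightarrow> Y"
    using convergent_sqrt_iter[OF X] by (auto simp: convergent_def)
  have "norm Y \<le> 1"
    by (rule LIMSEQ_le_const2[OF tendsto_norm[OF Y]])
       (meson norm_sqrt_iter[OF X] sqrt_bound_bounds order_trans)
  moreover have "selfadjoint Y"
  proof (rule LIMSEQ_selfadjoint[OF Y])
    show "selfadjoint (sqrt_iter X n)" for n
      by (induction n) (auto intro!: selfadjoint_0 selfadjoint_add selfadjoint_scaleR selfadjoint_square sa)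
  qed
  moreover have "(id_blinfun - Y) o\<^sub>L (id_blinfun - Y) = id_blinfun - X"
  proof -
    have "(\<lambda>n. sqrt_iter X (Suc n)) \<longlonglongrightarrow> (1/2) *\<^sub>R (X + (Y o\<^sub>L Y))"
      unfolding sqrt_iter.simps
      by (intro tendsto_intros Y bounded_bilinear.tendsto[OF bounded_bilinear_blinfun_compose])
    then have "Y = (1/2) *\<^sub>R (X + (Y o\<^sub>L Y))"
      using LIMSEQ_Suc[OF Y] LIMSEQ_unique by blast
    then have "2 *\<^sub>R Y = X + (Y o\<^sub>L Y)"
      by (metis scaleR_half_double scaleR_scaleR scaleR_right_distrib scaleR_2)
    then have "2 *\<^sub>R Y x = X x + Y (Y x)" for x
      by (metis blinfun.add_left blinfun.scaleR_left blinfun_apply_blinfun_compose)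
    then show ?thesis
      by (intro blinfun_eqI) (simp add: blinfun.bilinear_simps algebra_simps scaleR_2)
  qed
  moreover have "Y o\<^sub>L J = J o\<^sub>L Y" if J: "X o\<^sub>L J = J o\<^sub>L X" for J
  proof -
    have J': "X (J x) = J (X x)" for x
      using J by (metis blinfun_apply_blinfun_compose)
    have "sqrt_iter X n o\<^sub>L J = J o\<^sub>L sqrt_iter X n" for n
    proof (induction n)
      case (Suc n)
      then have "sqrt_iter X n (J x) = J (sqrt_iter X n x)" for x
        by (metis blinfun_apply_blinfun_compose)
      then show ?case
        by (intro blinfun_eqI) (simp add: blinfun.bilinear_simps J')
    qed (simp add: blinfun_eqI)
    moreover have "(\<lambda>n. sqrt_iter X n o\<^sub>L J) \<longlonglongrightarrow> (Y o\<^sub>L J)"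
        "(\<lambda>n. J o\<^sub>L sqrt_iter X n) \<longlonglongrightarrow> (J o\<^sub>L Y)"
      by (intro bounded_bilinear.tendsto[OF bounded_bilinear_blinfun_compose] Y tendsto_const)+
    ultimately show ?thesis
      by (simp add: LIMSEQ_unique)
  qed
  ultimately show ?thesis
    using that by blast
qed

text \<open>This makes the root \<open>1 - Y\<close> from \<open>sqrt_fixpoint\<close> a positive
  operator; it is Cauchy-Schwarz for \<open>Y x\<close> and \<open>x\<close>.\<close>

lemma inner_contraction_nonneg:
  fixes Y :: "'a::real_inner \<Rightarrow>\<^sub>L 'a"
  assumes "norm Y \<le> 1"
  shows "(id_blinfun - Y) x \<bullet> x \<ge> 0"
proof -
  have "Y x \<bullet> x \<le> norm (Y x) * norm x"
    by (rule norm_cauchy_schwarz)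
  also have "\<dots> \<le> (norm Y * norm x) * norm x"
    by (intro mult_right_mono norm_blinfun) simp
  also have "\<dots> \<le> (1 * norm x) * norm x"
    by (intro mult_right_mono assms) auto
  finally show ?thesis
    by (simp add: blinfun.diff_left inner_diff_left dot_square_norm power2_eq_square)
qed

text \<open>A scaled \<open>S T\<close> is written as \<open>1 - X\<close> with a symmetric
  contraction \<open>X\<close>, whose fixpoint gives the root \<open>1 - Y\<close>. As
  \<open>Y\<close> is again a symmetric contraction, the same step gives a root \<open>1 - Z\<close>
  of \<open>1 - Y\<close>.\<close>

lemma exists_abs_blinfun:
  fixes T S :: "'a::{real_inner,banach} \<Rightarrow>\<^sub>L 'a"
  assumes adj: "\<And>x y. T x \<bullet> y = x \<bullet> S y"
  obtains A B where "selfadjoint A" "selfadjoint B" "\<And>x. A x \<bullet> x \<ge> 0"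
    "\<And>x. A (A x) = S (T x)" "\<And>x. B (B x) = A x"
    "\<forall>J. T o\<^sub>L J = J o\<^sub>L T \<longrightarrow> S o\<^sub>L J = J o\<^sub>L S \<longrightarrow> A o\<^sub>L J = J o\<^sub>L A \<and> B o\<^sub>L J = J o\<^sub>L B"
proof -
  \<comment> \<open>The scale must be at least the square of \<open>norm S\<close> for
    \<open>X\<close> to be a contraction; the added 1 keeps it positive when
    \<open>S = 0\<close>.\<close>
  define c where "c = (norm S)\<^sup>2 + 1"
  have c: "c > 0" by (simp add: c_def add_nonneg_pos)
  define X where "X = id_blinfun - (1/c) *\<^sub>R (S o\<^sub>L T)"
  have Xx: "X x = x - (1/c) *\<^sub>R S (T x)" for x
    by (simp add: X_def blinfun.bilinear_simps)
  have "norm X \<le> 1"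
  proof (rule norm_blinfun_bound)
    fix x
    have "(norm (S (T x)))\<^sup>2 \<le> (norm S * norm (T x))\<^sup>2"
      by (intro power_mono norm_blinfun) simp
    also have "\<dots> \<le> c * (norm (T x))\<^sup>2"
      unfolding c_def power_mult_distrib by (intro mult_right_mono) auto
    finally have *: "(norm (S (T x)))\<^sup>2 / c\<^sup>2 \<le> (norm (T x))\<^sup>2 / c"
      using c by (simp add: field_simps power2_eq_square)
    \<comment> \<open>With \<open>w = S (T x)\<close> the adjoint relation turns
      \<open>x \<bullet> w\<close> into the square of \<open>norm (T x)\<close>. For
      \<open>k = 1/c\<close> the negative cross term then outweighs the quadratic one.\<close>
    have "(norm (x - k *\<^sub>R w))\<^sup>2 = (norm x)\<^sup>2 - 2 * k * (x \<bullet> w) + k\<^sup>2 * (norm w)\<^sup>2" for k w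
      unfolding power2_norm_eq_inner
      by (simp add: inner_diff_left inner_diff_right inner_commute algebra_simps power2_eq_square)
    then have "(norm (X x))\<^sup>2 = (norm x)\<^sup>2 - 2 * (norm (T x))\<^sup>2 / c + (norm (S (T x)))\<^sup>2 / c\<^sup>2"
      using adj[of x "T x"] by (simp add: Xx power2_norm_eq_inner power_divide)
    also have "\<dots> \<le> (norm x)\<^sup>2 - (norm (T x))\<^sup>2 / c"
      using * by simp
    also have "\<dots> \<le> (norm x)\<^sup>2"
      using c by simp
    finally show "norm (X x) \<le> 1 * norm x"
      by (simp add: power2_le_iff_abs_le)
  qed simp
  moreover have "selfadjoint X"
    by (simp add: selfadjoint_def Xx inner_diff_left inner_diff_right adj[symmetric])
       (metis adj inner_commute)
  ultimately obtain Y where Y: "norm Y \<le> 1" "selfadjoint Y"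
      "(id_blinfun - Y) o\<^sub>L (id_blinfun - Y) = id_blinfun - X"
      "\<And>J. X o\<^sub>L J = J o\<^sub>L X \<Longrightarrow> Y o\<^sub>L J = J o\<^sub>L Y"
    using sqrt_fixpoint by metis
  from Y(1,2) obtain Z where Z: "selfadjoint Z"
      "(id_blinfun - Z) o\<^sub>L (id_blinfun - Z) = id_blinfun - Y"
      "\<And>J. Y o\<^sub>L J = J o\<^sub>L Y \<Longrightarrow> Z o\<^sub>L J = J o\<^sub>L Z"
    using sqrt_fixpoint by metis
  have YY: "(id_blinfun - Y) ((id_blinfun - Y) x) = x - X x" for x
    using Y(3) by (metis blinfun.diff_left blinfun_apply_blinfun_compose blinfun_apply_id_blinfun id_apply)
  have ZZ: "(id_blinfun - Z) ((id_blinfun - Z) x) = (id_blinfun - Y) x" for x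
    using Z(2) by (metis blinfun_apply_blinfun_compose)
  \<comment> \<open>The scalars undo the division by \<open>c\<close>: \<open>A\<close> squares to
    \<open>c (1 - X) = S T\<close>, and \<open>B\<close> squares to
    \<open>sqrt c (1 - Y) = A\<close>.\<close>
  define A where "A = sqrt c *\<^sub>R (id_blinfun - Y)"
  define B where "B = sqrt (sqrt c) *\<^sub>R (id_blinfun - Z)"
  show ?thesis
  proof (rule that)
    show "selfadjoint A" "selfadjoint B"
      unfolding A_def B_def by (intro selfadjoint_scaleR selfadjoint_diff selfadjoint_id Y Z)+
    show "A x \<bullet> x \<ge> 0" for x
      using inner_contraction_nonneg[OF Y(1), of x] c by (simp add: A_def blinfun.scaleR_left)
    show "A (A x) = S (T x)" for x
      using c YY[of x] by (simp add: A_def blinfun.scaleR_left blinfun.scaleR_right Xx)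
    show "B (B x) = A x" for x
      using c ZZ[of x] by (simp add: A_def B_def blinfun.scaleR_left blinfun.scaleR_right)
  next
    have "A o\<^sub>L J = J o\<^sub>L A \<and> B o\<^sub>L J = J o\<^sub>L B"
      if T: "T o\<^sub>L J = J o\<^sub>L T" and S: "S o\<^sub>L J = J o\<^sub>L S" for J
    proof -
      have "T (J x) = J (T x)" "S (J x) = J (S x)" for x
        using T S by (metis blinfun_apply_blinfun_compose)+
      then have "X o\<^sub>L J = J o\<^sub>L X"
        by (intro blinfun_eqI) (simp add: Xx blinfun.bilinear_simps)
      note YJ = Y(4)[OF this]
      have "Y (J x) = J (Y x)" "Z (J x) = J (Z x)" for x
        using YJ Z(3)[OF YJ] by (metis blinfun_apply_blinfun_compose)+
      then show ?thesis
        by (auto intro!: blinfun_eqI simp: A_def B_def blinfun.bilinear_simps)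
    qed
    then show "\<forall>J. T o\<^sub>L J = J o\<^sub>L T \<longrightarrow> S o\<^sub>L J = J o\<^sub>L S \<longrightarrow> A o\<^sub>L J = J o\<^sub>L A \<and> B o\<^sub>L J = J o\<^sub>L B"
      by blast
  qed
qed

text \<open>
  With \<open>J\<close> the multiplication by \<open>\<i>\<close>, this is the complex rank one operator \<open>x \<mapsto> \<langle>x, u\<rangle> v\<close>, written
  through the real inner product.
\<close>

lift_definition rank_one :: "('a::real_inner \<Rightarrow>\<^sub>L 'a) \<Rightarrow> 'a \<Rightarrow> 'a \<Rightarrow> ('a \<Rightarrow>\<^sub>L 'a)"
  is "\<lambda>J u v x. (x \<bullet> u) *\<^sub>R v + (x \<bullet> J u) *\<^sub>R J v"
  by (intro bounded_linear_add bounded_linear_scaleR_const bounded_linear_inner_left)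

lemma rank_one_adjoint: "rank_one J u v x \<bullet> y = x \<bullet> rank_one J v u y"
  by (simp add: rank_one.rep_eq inner_add_left inner_add_right inner_commute mult.commute)

section \<open>The Hilbert space of square summable complex sequences\<close>

text \<open>By the parallelogram law the square norms of \<open>a n + b n\<close> and
  \<open>a n - b n\<close> add up to the majorant.\<close>

lemma summable_square_add:
  fixes a b :: "nat \<Rightarrow> 'a::real_inner"
  assumes "summable (\<lambda>n. (norm (a n))\<^sup>2)" "summable (\<lambda>n. (norm (b n))\<^sup>2)"
  shows "summable (\<lambda>n. (norm (a n + b n))\<^sup>2)"
proof (rule summable_comparison_test'[of "\<lambda>n. 2 * (norm (a n))\<^sup>2 + 2 * (norm (b n))\<^sup>2" 0])
  fix n
  have "0 \<le> (norm (a n - b n))\<^sup>2" "0 \<le> (norm (a n + b n))\<^sup>2"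
    by simp_all
  then show "norm ((norm (a n + b n))\<^sup>2) \<le> 2 * (norm (a n))\<^sup>2 + 2 * (norm (b n))\<^sup>2"
    by (simp add: power2_norm_eq_inner inner_simps inner_commute)
qed (intro summable_add summable_mult assms)

lemma summable_inner_square_summable:
  fixes a b :: "nat \<Rightarrow> 'a::real_inner"
  assumes "summable (\<lambda>n. (norm (a n))\<^sup>2)" "summable (\<lambda>n. (norm (b n))\<^sup>2)"
  shows "summable (\<lambda>n. norm (a n) * norm (b n))" "summable (\<lambda>n. a n \<bullet> b n)"
proof -
  show 1: "summable (\<lambda>n. norm (a n) * norm (b n))"
  proof (rule summable_comparison_test'[of "\<lambda>n. (norm (a n))\<^sup>2 + (norm (b n))\<^sup>2" 0])
    fix n
    show "norm (norm (a n) * norm (b n)) \<le> (norm (a n))\<^sup>2 + (norm (b n))\<^sup>2"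
      using sum_squares_bound[of "norm (a n)" "norm (b n)"]
        mult_nonneg_nonneg[OF norm_ge_zero[of "a n"] norm_ge_zero[of "b n"]]
      by (simp only: real_norm_def abs_mult abs_norm_cancel)
  qed (intro summable_add assms)
  show "summable (\<lambda>n. a n \<bullet> b n)"
    by (rule summable_comparison_test'[OF 1, of 0]) (simp add: Cauchy_Schwarz_ineq2)
qed

text \<open>A type rather than a set of sequences, so that it can be an instance of
  \<open>real_inner\<close> and \<open>banach\<close> and carry the operator type
  \<open>\<Rightarrow>\<^sub>L\<close>.\<close>

typedef ell2 = "{a :: nat \<Rightarrow> complex. summable (\<lambda>n. (norm (a n))\<^sup>2)}"
  morphisms coord Abs_ell2
  by (rule exI[of _ "\<lambda>n. 0"]) simp

setup_lifting type_definition_ell2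

lemma summable_coord: "summable (\<lambda>n. (norm (coord x n))\<^sup>2)"
  using coord[of x] by simp

lemma ell2_eqI: "(\<And>n. coord x n = coord y n) \<Longrightarrow> x = y"
  by (metis coord_inject ext)

instantiation ell2 :: real_inner
begin

lift_definition zero_ell2 :: ell2 is "\<lambda>n. 0" by simp
lift_definition plus_ell2 :: "ell2 \<Rightarrow> ell2 \<Rightarrow> ell2" is "\<lambda>a b n. a n + b n"
  by (rule summable_square_add)
lift_definition uminus_ell2 :: "ell2 \<Rightarrow> ell2" is "\<lambda>a n. - a n" by simp
lift_definition minus_ell2 :: "ell2 \<Rightarrow> ell2 \<Rightarrow> ell2" is "\<lambda>a b n. a n - b n"
  using summable_square_add[of _ "\<lambda>n. - _ n"] by simp
lift_definition scaleR_ell2 :: "real \<Rightarrow> ell2 \<Rightarrow> ell2" is "\<lambda>r a n. r *\<^sub>R a n"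
  by (simp add: power_mult_distrib summable_mult)
text \<open>Since \<open>\<bullet>\<close> on complex numbers is the real part of
  \<open>a * cnj b\<close>, this is the real part of the usual sesquilinear product.\<close>

definition inner_ell2 :: "ell2 \<Rightarrow> ell2 \<Rightarrow> real" where
  "inner_ell2 x y = (\<Sum>n. coord x n \<bullet> coord y n)"
definition norm_ell2 :: "ell2 \<Rightarrow> real" where
  "norm_ell2 x = sqrt (inner x x)"
definition dist_ell2 :: "ell2 \<Rightarrow> ell2 \<Rightarrow> real" where
  "dist_ell2 x y = norm (x - y)"
definition sgn_ell2 :: "ell2 \<Rightarrow> ell2" where
  "sgn_ell2 x = inverse (norm x) *\<^sub>R x"
definition uniformity_ell2 :: "(ell2 \<times> ell2) filter" where
  "uniformity_ell2 = (INF e\<in>{0<..}. principal {(x, y). dist x y < e})"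
definition open_ell2 :: "ell2 set \<Rightarrow> bool" where
  "open_ell2 U \<longleftrightarrow> (\<forall>x\<in>U. \<forall>\<^sub>F (x', y) in uniformity. x' = x \<longrightarrow> y \<in> U)"

instance
proof
  fix x y z :: ell2 and r s :: real
  show "x + y + z = x + (y + z)" "x + y = y + x" "0 + x = x" "- x + x = 0" "x - y = x + - y"
    by (rule ell2_eqI; simp add: plus_ell2.rep_eq zero_ell2.rep_eq uminus_ell2.rep_eq minus_ell2.rep_eq)+
  show "r *\<^sub>R (x + y) = r *\<^sub>R x + r *\<^sub>R y" "(r + s) *\<^sub>R x = r *\<^sub>R x + s *\<^sub>R x"
    "r *\<^sub>R s *\<^sub>R x = (r * s) *\<^sub>R x" "1 *\<^sub>R x = x"
    by (rule ell2_eqI; simp add: plus_ell2.rep_eq scaleR_ell2.rep_eq algebra_simps)+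
  have sm: "summable (\<lambda>n. coord x n \<bullet> coord y n)" for x y
    by (intro summable_inner_square_summable summable_coord)
  show "x \<bullet> y = y \<bullet> x"
    by (simp add: inner_ell2_def inner_commute)
  show "(x + y) \<bullet> z = x \<bullet> z + y \<bullet> z"
    by (simp add: inner_ell2_def plus_ell2.rep_eq inner_add_left suminf_add sm)
  show "r *\<^sub>R x \<bullet> y = r * (x \<bullet> y)"
    by (simp add: inner_ell2_def scaleR_ell2.rep_eq suminf_mult sm del: inner_complex_def)
  show "0 \<le> x \<bullet> x"
    unfolding inner_ell2_def by (intro suminf_nonneg sm) simp
  show "x \<bullet> x = 0 \<longleftrightarrow> x = 0"
  proof
    assume "x \<bullet> x = 0"
    then have "\<forall>n. coord x n \<bullet> coord x n = 0"
      using suminf_eq_zero_iff[OF sm[of x x]] by (simp add: inner_ell2_def)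
    then show "x = 0"
      by (intro ell2_eqI) (simp add: zero_ell2.rep_eq)
  qed (simp add: inner_ell2_def zero_ell2.rep_eq)
qed (simp_all add: norm_ell2_def dist_ell2_def sgn_ell2_def uniformity_ell2_def open_ell2_def)

end

lemma summable_inner_coord: "summable (\<lambda>n. coord x n \<bullet> coord y n)"
  by (intro summable_inner_square_summable summable_coord)

lemma norm_ell2_power2: "(norm x)\<^sup>2 = (\<Sum>n. (norm (coord x n))\<^sup>2)"
  by (simp add: power2_norm_eq_inner inner_ell2_def)

lemma sum_coord_le: "finite N \<Longrightarrow> (\<Sum>n\<in>N. (norm (coord x n))\<^sup>2) \<le> (norm x)\<^sup>2"
  unfolding norm_ell2_power2 by (rule sum_le_suminf[OF summable_coord]) auto

lemma norm_coord_le: "norm (coord x n) \<le> norm x"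
  using sum_coord_le[of "{n}" x] by (simp add: power2_le_iff_abs_le)

lemma bounded_linear_coord: "bounded_linear (\<lambda>x. coord x n)"
  by (rule bounded_linear_intro[of _ 1])
     (auto simp: plus_ell2.rep_eq scaleR_ell2.rep_eq norm_coord_le)

text \<open>A Fatou argument: the bound passes to the coordinatewise limit on each finite partial
  sum, and then to the whole series. It also shows that \<open>l\<close> is square summable.\<close>

lemma ell2_limit_coord:
  fixes X :: "nat \<Rightarrow> ell2" and l :: "nat \<Rightarrow> complex"
  assumes l: "\<And>n. (\<lambda>k. coord (X k) n) \<longlonglongrightarrow> l n" and "\<epsilon> \<ge> 0"
    and bound: "\<And>k. k \<ge> M \<Longrightarrow> norm (X k - y) \<le> \<epsilon>"
  shows "\<exists>z. coord z = l \<and> norm (z - y) \<le> \<epsilon>"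
proof -
  have fin: "(\<Sum>n<N. (norm (l n - coord y n))\<^sup>2) \<le> \<epsilon>\<^sup>2" for N
  proof (rule LIMSEQ_le_const2)
    show "(\<lambda>k. \<Sum>n<N. (norm (coord (X k) n - coord y n))\<^sup>2) \<longlonglongrightarrow> (\<Sum>n<N. (norm (l n - coord y n))\<^sup>2)"
      by (intro tendsto_intros l)
    have "(\<Sum>n<N. (norm (coord (X k) n - coord y n))\<^sup>2) \<le> \<epsilon>\<^sup>2" if "k \<ge> M" for k
      using sum_coord_le[of "{..<N}" "X k - y"] power_mono[OF bound[OF that], of 2]
      by (simp add: minus_ell2.rep_eq)
    then show "\<exists>K. \<forall>k\<ge>K. (\<Sum>n<N. (norm (coord (X k) n - coord y n))\<^sup>2) \<le> \<epsilon>\<^sup>2"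
      by blast
  qed
  have sm: "summable (\<lambda>n. (norm (l n - coord y n))\<^sup>2)"
    by (rule bounded_imp_summable[of _ "\<epsilon>\<^sup>2"]) (use fin[of "Suc _"] in \<open>auto simp: lessThan_Suc_atMost\<close>)
  have "summable (\<lambda>n. (norm (l n))\<^sup>2)"
    using summable_square_add[OF sm summable_coord[of y]] by simp
  then obtain z where z: "coord z = l"
    using coord_cases by blast
  have "(norm (z - y))\<^sup>2 \<le> \<epsilon>\<^sup>2"
    unfolding norm_ell2_power2 minus_ell2.rep_eq z
    by (rule suminf_le_const[OF sm fin])
  then show ?thesis
    using z \<open>\<epsilon> \<ge> 0\<close> power2_le_imp_le by blast
qed

instance ell2 :: banach
proof
  fix X :: "nat \<Rightarrow> ell2"
  assume X: "Cauchy X"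
  have "convergent (\<lambda>k. coord (X k) n)" for n
    using bounded_linear.Cauchy[OF bounded_linear_coord X] by (simp add: Cauchy_convergent_iff)
  then obtain l where l: "\<And>n. (\<lambda>k. coord (X k) n) \<longlonglongrightarrow> l n"
    unfolding convergent_def by metis
  \<comment> \<open>Square summability of \<open>l\<close> is part of the claim, which is why
    \<open>z\<close> is quantified here; as \<open>coord\<close> is injective, all these
    \<open>z\<close> are the same vector.\<close>
  have near: "\<exists>M. \<forall>m\<ge>M. \<exists>z. coord z = l \<and> norm (z - X m) \<le> \<epsilon>" if "\<epsilon> > 0" for \<epsilon>
  proof -
    obtain M where M: "\<forall>m\<ge>M. \<forall>k\<ge>M. norm (X m - X k) < \<epsilon>"
      using CauchyD[OF X \<open>\<epsilon> > 0\<close>] by blast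
    have "\<exists>z. coord z = l \<and> norm (z - X m) \<le> \<epsilon>" if "m \<ge> M" for m
      by (rule ell2_limit_coord[OF l, where M = M]) (use M that \<open>\<epsilon> > 0\<close> in \<open>auto intro: less_imp_le\<close>)
    then show ?thesis
      by blast
  qed
  obtain z where z: "coord z = l"
    using near[of 1] by force
  have "X \<longlonglongrightarrow> z"
  proof (rule LIMSEQ_I)
    fix r :: real assume "r > 0"
    then obtain M where "\<forall>m\<ge>M. \<exists>z. coord z = l \<and> norm (z - X m) \<le> r / 2"
      using near[of "r / 2"] by auto
    then have "norm (z - X m) \<le> r / 2" if "m \<ge> M" for m
      using z that by (metis coord_inject)
    then have "norm (X m - z) < r" if "m \<ge> M" for m
      using \<open>r > 0\<close> that by (force simp: norm_minus_commute)
    then show "\<exists>M. \<forall>m\<ge>M. norm (X m - z) < r"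
      by blast
  qed
  then show "convergent X"
    by (auto simp: convergent_def)
qed

section \<open>Coordinate vectors and the complex structure\<close>

lift_definition unit_vec :: "nat \<Rightarrow> ell2" is "\<lambda>n k. if k = n then 1 else 0"
  by (rule summable_finite[of "{_}"]) auto

lift_definition mul_i_ell2 :: "ell2 \<Rightarrow> ell2" is "\<lambda>a n. \<i> * a n"
  by (simp add: norm_mult)

text \<open>Packaged as an operator so that complex linearity of a real operator becomes commutation
  with \<open>mul_i\<close>.\<close>

lift_definition mul_i :: "ell2 \<Rightarrow>\<^sub>L ell2" is mul_i_ell2
  by (rule bounded_linear_intro[of _ 1])
     (auto intro!: ell2_eqI simp: plus_ell2.rep_eq scaleR_ell2.rep_eq mul_i_ell2.rep_eq algebra_simps
       norm_ell2_def inner_ell2_def inner_complex_def add.commute)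

lemma coord_mul_i: "coord (mul_i x) n = \<i> * coord x n"
  by (simp add: mul_i.rep_eq mul_i_ell2.rep_eq)

lemma mul_i_mul_i: "mul_i (mul_i x) = - x"
  by (rule ell2_eqI) (simp add: coord_mul_i uminus_ell2.rep_eq)

lemma mul_i_skew: "mul_i x \<bullet> y = - (x \<bullet> mul_i y)"
proof -
  have "coord (mul_i x) n \<bullet> coord y n = - (coord x n \<bullet> coord (mul_i y) n)" for n
    by (simp add: coord_mul_i inner_complex_def)
  then show ?thesis
    unfolding inner_ell2_def by (simp add: suminf_minus summable_inner_coord)
qed

lemma inner_unit_vec: "x \<bullet> unit_vec n = Re (coord x n)"
proof -
  have "x \<bullet> unit_vec n = (\<Sum>k\<in>{n}. coord x k \<bullet> coord (unit_vec n) k)"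
    unfolding inner_ell2_def by (rule suminf_finite) (auto simp: unit_vec.rep_eq)
  then show ?thesis
    by (simp add: unit_vec.rep_eq inner_complex_def)
qed

lemma inner_mul_i_unit_vec: "x \<bullet> mul_i (unit_vec n) = Im (coord x n)"
  using mul_i_skew[of x "unit_vec n"] by (simp add: inner_unit_vec coord_mul_i)

lemma norm_unit_vec: "norm (unit_vec n) = 1"
  by (simp add: norm_eq_sqrt_inner inner_unit_vec unit_vec.rep_eq)

text \<open>Over the reals the vectors \<open>unit_vec n\<close> and
  \<open>mul_i (unit_vec n)\<close> together form an orthonormal basis; they read off the real and
  imaginary parts of the coordinates.\<close>

lemma parseval_ell2:
  "(\<lambda>n. (x \<bullet> unit_vec n)\<^sup>2 + (x \<bullet> mul_i (unit_vec n))\<^sup>2) sums (norm x)\<^sup>2"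
  using summable_sums[OF summable_coord[of x]]
  by (simp add: inner_unit_vec inner_mul_i_unit_vec norm_ell2_power2 cmod_power2)

lemma mul_i_isometry: "mul_i x \<bullet> mul_i y = x \<bullet> y"
  by (simp add: mul_i_skew mul_i_mul_i)

lemma norm_mul_i: "norm (mul_i x) = norm x"
  by (simp add: norm_eq_sqrt_inner mul_i_isometry)

section \<open>Square sums along orthonormal families\<close>

lemma square_trace_summable_on:
  assumes B: "selfadjoint B" "B o\<^sub>L mul_i = mul_i o\<^sub>L B"
    and sm: "summable (\<lambda>n. (norm (B (unit_vec n)))\<^sup>2)"
    and orth: "\<And>e e'. e \<in> E \<Longrightarrow> e' \<in> E \<Longrightarrow> e \<bullet> e' = (if e = e' then 1 else 0)"
  shows "(\<lambda>e. (norm (B e))\<^sup>2) summable_on E"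
proof (rule nonneg_bdd_above_summable_on)
  define C where "C = (\<Sum>n. 2 * (norm (B (unit_vec n)))\<^sup>2)"
  have BJ: "B (mul_i x) = mul_i (B x)" for x
    using B(2) by (metis blinfun_apply_blinfun_compose)
  have "(\<Sum>e\<in>F. (norm (B e))\<^sup>2) \<le> C" if "F \<subseteq> E" "finite F" for F
  proof -
    have *: "(\<Sum>e\<in>F. (e \<bullet> x)\<^sup>2) \<le> (norm x)\<^sup>2" for x
      by (rule Bessel_inequality) (use that in \<open>auto simp: orth subset_iff\<close>)
    have 1: "(\<lambda>n. \<Sum>e\<in>F. (B e \<bullet> unit_vec n)\<^sup>2 + (B e \<bullet> mul_i (unit_vec n))\<^sup>2)
        sums (\<Sum>e\<in>F. (norm (B e))\<^sup>2)"
      by (intro sums_sum parseval_ell2)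
    have 2: "(\<lambda>n. 2 * (norm (B (unit_vec n)))\<^sup>2) sums C"
      unfolding C_def by (intro summable_sums summable_mult sm)
    \<comment> \<open>Symmetry moves \<open>B\<close> onto the basis vectors, and Bessel applies to
      \<open>B (unit_vec n)\<close> and to \<open>B (mul_i (unit_vec n))\<close> separately. Both
      have the same norm, hence the factor 2.\<close>
    have "(\<Sum>e\<in>F. (B e \<bullet> unit_vec n)\<^sup>2 + (B e \<bullet> mul_i (unit_vec n))\<^sup>2)
        \<le> 2 * (norm (B (unit_vec n)))\<^sup>2" for n
      using *[of "B (unit_vec n)"] *[of "B (mul_i (unit_vec n))"]
      by (simp add: selfadjointD[OF B(1)] sum.distrib BJ norm_mul_i)
    from sums_le[OF this 1 2] show ?thesis .
  qed
  then show "bdd_above (sum (\<lambda>e. (norm (B e))\<^sup>2) ` {F. F \<subseteq> E \<and> finite F})"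
    by (auto intro!: bdd_aboveI[of _ C])
qed simp

text \<open>The two real rank one pieces are estimated one by one, which costs a factor 2 and is
  enough for summability.\<close>

lemma norm_rank_one_mul_i:
  fixes u v :: ell2
  shows "norm (rank_one mul_i u v) \<le> 2 * norm u * norm v"
proof (rule norm_blinfun_bound)
  fix x :: ell2
  have "\<bar>x \<bullet> w\<bar> * norm v \<le> norm x * norm w * norm v" for w :: ell2
    by (intro mult_right_mono Cauchy_Schwarz_ineq2) simp
  from this[of u] this[of "mul_i u"]
  have "norm ((x \<bullet> u) *\<^sub>R v) + norm ((x \<bullet> mul_i u) *\<^sub>R mul_i v) \<le> 2 * norm u * norm v * norm x"
    by (simp add: norm_mul_i algebra_simps)
  then show "norm (rank_one mul_i u v x) \<le> 2 * norm u * norm v * norm x"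
    unfolding rank_one.rep_eq by (rule order_trans[OF norm_triangle_ineq])
qed simp

lemma rank_one_mul_i_commute:
  fixes u v x :: ell2
  shows "rank_one mul_i u v (mul_i x) = mul_i (rank_one mul_i u v x)"
  by (simp add: rank_one.rep_eq mul_i_isometry mul_i_skew[of x] mul_i_mul_i blinfun.bilinear_simps)

text \<open>Collects, in real terms, all that membership in the trace class requires of the operator
  sending each \<open>unit_vec n\<close> to \<open>v n\<close>. The adjoint \<open>S\<close> is the
  sum of the rank one operators with their two vectors swapped.\<close>

lemma exists_trace_class_blinfun:
  fixes v :: "nat \<Rightarrow> ell2"
  assumes v: "summable (\<lambda>n. norm (v n))"
  obtains T S A :: "ell2 \<Rightarrow>\<^sub>L ell2" where
    "\<And>x. (\<lambda>n. rank_one mul_i (unit_vec n) (v n) x) sums T x"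
    "\<And>x y. T x \<bullet> y = x \<bullet> S y" "\<And>x. A (A x) = S (T x)" "\<And>x. A x \<bullet> x \<ge> 0" "selfadjoint A"
    "\<And>x. T (mul_i x) = mul_i (T x)" "\<And>x. S (mul_i x) = mul_i (S x)" "\<And>x. A (mul_i x) = mul_i (A x)"
    "\<And>E. \<forall>e\<in>E. \<forall>e'\<in>E. e \<bullet> e' = (if e = e' then 1 else 0) \<Longrightarrow> (\<lambda>e. A e \<bullet> e) summable_on E"
proof -
  define T where "T = (\<Sum>n. rank_one mul_i (unit_vec n) (v n))"
  define S where "S = (\<Sum>n. rank_one mul_i (v n) (unit_vec n))"
  have "summable (\<lambda>n. rank_one mul_i (unit_vec n) (v n))" "summable (\<lambda>n. rank_one mul_i (v n) (unit_vec n))"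
    by (rule summable_comparison_test'[OF summable_mult[OF v, of 2], of 0],
        rule order_trans[OF norm_rank_one_mul_i], simp add: norm_unit_vec)+
  then have sT: "(\<lambda>n. rank_one mul_i (unit_vec n) (v n) x) sums T x"
    and sS: "(\<lambda>n. rank_one mul_i (v n) (unit_vec n) x) sums S x" for x
    unfolding T_def S_def
    by (auto intro!: bounded_linear.sums[OF blinfun.bounded_linear_left] summable_sums)
  have adj: "T x \<bullet> y = x \<bullet> S y" for x y
    using bounded_linear.sums[OF bounded_linear_inner_left sT, of x y]
      bounded_linear.sums[OF bounded_linear_inner_right sS, of x y]
    by (simp add: rank_one_adjoint sums_unique2)
  have TJ: "T (mul_i x) = mul_i (T x)" for x
    using sT[of "mul_i x"] bounded_linear.sums[OF blinfun.bounded_linear_right sT, of mul_i x]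
    by (simp add: rank_one_mul_i_commute sums_unique2)
  have SJ: "S (mul_i x) = mul_i (S x)" for x
    using sS[of "mul_i x"] bounded_linear.sums[OF blinfun.bounded_linear_right sS, of mul_i x]
    by (simp add: rank_one_mul_i_commute sums_unique2)
  have comm: "T o\<^sub>L mul_i = mul_i o\<^sub>L T" "S o\<^sub>L mul_i = mul_i o\<^sub>L S"
    by (auto intro!: blinfun_eqI simp: TJ SJ)
  obtain A B where AB: "selfadjoint A" "selfadjoint B" "\<And>x. A x \<bullet> x \<ge> 0"
    "\<And>x. A (A x) = S (T x)" "\<And>x. B (B x) = A x"
    and J: "\<forall>J. T o\<^sub>L J = J o\<^sub>L T \<longrightarrow> S o\<^sub>L J = J o\<^sub>L S \<longrightarrow> A o\<^sub>L J = J o\<^sub>L A \<and> B o\<^sub>L J = J o\<^sub>L B"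
    by (rule exists_abs_blinfun[OF adj]) (rule that)
  have AJ: "A o\<^sub>L mul_i = mul_i o\<^sub>L A" and BJ: "B o\<^sub>L mul_i = mul_i o\<^sub>L B"
    using J comm by blast+
  have BB: "(norm (B x))\<^sup>2 = A x \<bullet> x" for x
    using selfadjointD[OF AB(2), of x "B x"] inner_commute[of x "A x"]
    by (simp add: power2_norm_eq_inner AB(5))
  have "T (unit_vec n) = v n" for n
  proof -
    have "rank_one mul_i (unit_vec k) (v k) (unit_vec n) = (if k = n then v n else 0)" for k
      by (simp add: rank_one.rep_eq inner_unit_vec inner_mul_i_unit_vec unit_vec.rep_eq)
    then have "(\<lambda>k. if k = n then v n else 0) sums T (unit_vec n)"
      using sT[of "unit_vec n"] by simp
    then show ?thesis
      using sums_single[of n "\<lambda>_. v n"] sums_unique2 by blast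
  qed
  \<comment> \<open>Both sides equal \<open>A (A x) \<bullet> x = S (T x) \<bullet> x\<close>, so
    \<open>A\<close> and \<open>T\<close> have the same norms on the basis vectors.\<close>
  moreover have "(norm (A x))\<^sup>2 = (norm (T x))\<^sup>2" for x
    using selfadjointD[OF AB(1), of x "A x"] adj[of x "T x"]
    by (simp add: power2_norm_eq_inner AB(4))
  ultimately have "norm (A (unit_vec n)) = norm (v n)" for n
    using power2_eq_imp_eq[of "norm (A (unit_vec n))" "norm (v n)"] by simp
  then have "A (unit_vec n) \<bullet> unit_vec n \<le> norm (v n)" for n
    using norm_cauchy_schwarz[of "A (unit_vec n)" "unit_vec n"] by (simp add: norm_unit_vec)
  then have "summable (\<lambda>n. (norm (B (unit_vec n)))\<^sup>2)"
    by (intro summable_comparison_test'[OF v, of 0]) (simp add: BB AB(3))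
  then have tr: "(\<lambda>e. A e \<bullet> e) summable_on E"
    if "\<forall>e\<in>E. \<forall>e'\<in>E. e \<bullet> e' = (if e = e' then 1 else 0)" for E
    using square_trace_summable_on[OF AB(2) BJ, of E] that by (simp add: BB)
  have AJ': "A (mul_i x) = mul_i (A x)" for x
    using AJ by (metis blinfun_apply_blinfun_compose)
  show ?thesis
    by (rule that) (fact sT adj AB TJ SJ AJ' tr)+
qed

section \<open>Identification of the Hardy space with square summable sequences\<close>

definition power_sums :: "(nat \<Rightarrow> complex) \<Rightarrow> (complex \<Rightarrow> complex) \<Rightarrow> bool" where
  "power_sums a f \<longleftrightarrow> (\<forall>z\<in>ball 0 1. (\<lambda>n. a n * z ^ n) sums f z)"

lemma power_sumsD: "power_sums a f \<Longrightarrow> norm z < 1 \<Longrightarrow> (\<lambda>n. a n * z ^ n) sums f z"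
  by (simp add: power_sums_def)

lemma power_sums_holomorphic: "power_sums a f \<Longrightarrow> f holomorphic_on ball 0 1"
  by (rule power_series_holomorphic[where a = a]) (simp add: power_sums_def)

lemma holomorphic_power_sums:
  "f holomorphic_on ball 0 1 \<Longrightarrow> power_sums (\<lambda>n. (deriv ^^ n) f 0 / fact n) f"
  unfolding power_sums_def using holomorphic_power_series[of f 0 1] by simp

lemma power_sums_abs_summable:
  assumes "power_sums a f" "0 \<le> r" "r < 1"
  shows "summable (\<lambda>n. norm (a n) * r ^ n)"
proof -
  \<comment> \<open>A radius strictly between \<open>r\<close> and 1: convergence at
    \<open>s\<close> forces absolute convergence at \<open>r\<close>.\<close>
  define s where "s = (r + 1) / 2"
  have "summable (\<lambda>n. a n * of_real s ^ n)"
    using power_sumsD[OF assms(1), of "of_real s"] assms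
    by (intro sums_summable) (auto simp: s_def)
  then have "summable (\<lambda>n. norm (a n * of_real r ^ n))"
    by (rule powser_insidea) (use assms in \<open>simp add: s_def\<close>)
  then show ?thesis
    using assms by (simp add: norm_mult norm_power)
qed

lemma continuous_on_circle:
  assumes "f holomorphic_on ball 0 1" "0 \<le> r" "r < 1"
  shows "continuous_on T (\<lambda>\<theta>. f (rcis r \<theta>))"
proof -
  have "continuous_on (ball 0 1) f"
    using assms(1) by (rule holomorphic_on_imp_continuous_on)
  moreover have "continuous_on T (\<lambda>\<theta>. rcis r \<theta>)"
    unfolding rcis_def cis_conv_exp by (intro continuous_intros)
  ultimately show ?thesis
    by (rule continuous_on_compose2) (use assms in \<open>auto simp: norm_mult rcis_def\<close>)
qed

text \<open>Termwise integration against a free weight \<open>k\<close>, justified by uniform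
  convergence on the circle. An exponential weight extracts coefficients, and the conjugate of a
  second function gives Parseval.\<close>

lemma circle_integral_sums:
  assumes f: "power_sums a f" and r: "0 \<le> r" "r < 1" and k: "continuous_on {0..2*pi} k"
  shows "(\<lambda>n. a n * of_real r ^ n * integral {0..2*pi} (\<lambda>\<theta>. cis (real n * \<theta>) * k \<theta>))
    sums integral {0..2*pi} (\<lambda>\<theta>. f (rcis r \<theta>) * k \<theta>)"
proof -
  obtain M where M: "\<forall>\<theta>\<in>{0..2*pi}. norm (k \<theta>) \<le> M"
    using compact_imp_bounded[OF compact_continuous_image[OF k compact_Icc]]
    by (auto simp: bounded_iff)
  have r': "norm (rcis r \<theta>) < 1" for \<theta>
    using r by simp
  have pow: "rcis r \<theta> ^ n = of_real r ^ n * cis (real n * \<theta>)" for n \<theta>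
    unfolding rcis_def power_mult_distrib Complex.DeMoivre by simp
  have sums: "(\<lambda>n. a n * of_real r ^ n * cis (real n * \<theta>) * k \<theta>) sums (f (rcis r \<theta>) * k \<theta>)" for \<theta>
    using sums_mult2[OF power_sumsD[OF f r'[of \<theta>]], of "k \<theta>"] by (simp add: pow mult.assoc)
  have "uniform_limit {0..2*pi} (\<lambda>N \<theta>. \<Sum>n<N. a n * of_real r ^ n * cis (real n * \<theta>) * k \<theta>)
      (\<lambda>\<theta>. \<Sum>n. a n * of_real r ^ n * cis (real n * \<theta>) * k \<theta>) sequentially"
  proof (rule Weierstrass_m_test)
    show "norm (a n * of_real r ^ n * cis (real n * \<theta>) * k \<theta>) \<le> (norm (a n) * r ^ n) * M"
      if "\<theta> \<in> {0..2*pi}" for n \<theta>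
      using M[rule_format, OF that] r by (auto simp: norm_mult norm_power intro!: mult_left_mono)
  qed (intro summable_mult2 power_sums_abs_summable[OF f r])
  then have unif: "uniform_limit {0..2*pi} (\<lambda>N \<theta>. \<Sum>n<N. a n * of_real r ^ n * cis (real n * \<theta>) * k \<theta>)
      (\<lambda>\<theta>. f (rcis r \<theta>) * k \<theta>) sequentially"
    by (simp only: sums_unique[OF sums, symmetric])
  have contt: "continuous_on {0..2*pi} (\<lambda>\<theta>. cis (real n * \<theta>) * k \<theta>)" for n
    unfolding cis_conv_exp by (intro continuous_intros k)
  then have cont: "continuous_on {0..2*pi} (\<lambda>\<theta>. \<Sum>n<N. a n * of_real r ^ n * cis (real n * \<theta>) * k \<theta>)" for N
    by (simp add: mult.assoc continuous_on_sum continuous_on_mult_left)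
  obtain I J where I: "\<And>N. ((\<lambda>\<theta>. \<Sum>n<N. a n * of_real r ^ n * cis (real n * \<theta>) * k \<theta>) has_integral I N) {0..2*pi}"
    and J: "((\<lambda>\<theta>. f (rcis r \<theta>) * k \<theta>) has_integral J) {0..2*pi}" and IJ: "I \<longlonglongrightarrow> J"
    using uniform_limit_integral[OF unif cont] by auto
  have I_eq: "I N = (\<Sum>n<N. a n * of_real r ^ n * integral {0..2*pi} (\<lambda>\<theta>. cis (real n * \<theta>) * k \<theta>))" for N
  proof (rule has_integral_unique[OF I])
    show "((\<lambda>\<theta>. \<Sum>n<N. a n * of_real r ^ n * cis (real n * \<theta>) * k \<theta>) has_integral
      (\<Sum>n<N. a n * of_real r ^ n * integral {0..2*pi} (\<lambda>\<theta>. cis (real n * \<theta>) * k \<theta>))) {0..2*pi}"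
      unfolding mult.assoc
      by (intro has_integral_sum has_integral_mult_right integrable_integral integrable_continuous_real contt) auto
  qed
  then show ?thesis
    using IJ integral_unique[OF J] by (simp add: sums_def I_eq[abs_def])
qed

lemma integral_cis_int:
  "integral {0..2*pi} (\<lambda>\<theta>. cis (real n * \<theta>) * cis (- (real m * \<theta>))) = (if n = m then 2 * pi else 0)"
proof (cases "n = m")
  case False
  define k :: complex where "k = \<i> * (of_nat n - of_nat m)"
  have k: "k \<noteq> 0"
    using False by (simp add: k_def)
  have *: "cis (real n * \<theta>) * cis (- (real m * \<theta>)) = exp (k * of_real \<theta>)" for \<theta>
    unfolding cis_mult unfolding cis_conv_exp by (simp add: k_def algebra_simps)
  have "((\<lambda>\<theta>::real. exp (k * of_real \<theta>)) has_integral
      exp (k * of_real (2 * pi)) / k - exp (k * of_real 0) / k) {0..2*pi}"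
  proof (rule fundamental_theorem_of_calculus)
    show "((\<lambda>\<theta>. exp (k * of_real \<theta>) / k) has_vector_derivative exp (k * of_real \<theta>))
        (at \<theta> within {0..2*pi})" for \<theta> :: real
      using k by (auto intro!: derivative_eq_intros has_vector_derivative_real_field)
  qed simp
  moreover have "exp (k * of_real (2 * pi)) = 1"
    using False unfolding exp_eq_1
    by (auto simp: k_def algebra_simps intro!: exI[of _ "int n - int m"])
  ultimately show ?thesis
    using False by (simp add: * integral_unique)
qed (simp add: cis_mult scaleR_conv_of_real)

lemma power_sums_coeff:
  fixes a :: "nat \<Rightarrow> complex"
  assumes "power_sums a f" "0 \<le> r" "r < 1"
  shows "integral {0..2*pi} (\<lambda>\<theta>. f (rcis r \<theta>) * cis (- (real m * \<theta>))) = 2 * pi * (a m * of_real r ^ m)"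
proof -
  have "continuous_on {0..2*pi} (\<lambda>\<theta>. cis (- (real m * \<theta>)))"
    unfolding cis_conv_exp by (intro continuous_intros)
  note sums = circle_integral_sums[OF assms this]
  have "a n * of_real r ^ n * integral {0..2*pi} (\<lambda>\<theta>. cis (real n * \<theta>) * cis (- (real m * \<theta>)))
      = (if n = m then 2 * pi * (a n * of_real r ^ n) else 0)" for n
    by (simp add: integral_cis_int)
  with sums have "(\<lambda>n. if n = m then 2 * pi * (a n * of_real r ^ n) else 0)
      sums integral {0..2*pi} (\<lambda>\<theta>. f (rcis r \<theta>) * cis (- (real m * \<theta>)))"
    by simp
  then show ?thesis
    using sums_single[of m "\<lambda>n. 2 * pi * (a n * of_real r ^ n)"] sums_unique2 by blast
qed

lemma power_sums_unique:
  assumes "power_sums a f" "power_sums b f"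
  shows "a = b"
proof
  fix m
  show "a m = b m"
    using power_sums_coeff[OF assms(1), of "1/2" m] power_sums_coeff[OF assms(2), of "1/2" m] by simp
qed

text \<open>With the weight \<open>cnj (g (rcis r \<theta>))\<close> the integrals left in
  \<open>circle_integral_sums\<close> are conjugates of those in \<open>power_sums_coeff\<close>.
  Each of the two series contributes a power of \<open>r\<close>, hence the square.\<close>

lemma parseval_circle:
  assumes f: "power_sums a f" and g: "power_sums b g" and r: "0 \<le> r" "r < 1"
  shows "(\<lambda>n. a n * cnj (b n) * of_real (r\<^sup>2) ^ n)
    sums (integral {0..2*pi} (\<lambda>\<theta>. f (rcis r \<theta>) * cnj (g (rcis r \<theta>))) / (2*pi))"
proof -
  have g': "continuous_on {0..2*pi} (\<lambda>\<theta>. cnj (g (rcis r \<theta>)))"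
    by (intro continuous_intros continuous_on_circle[OF power_sums_holomorphic[OF g] r])
  have "integral {0..2*pi} (\<lambda>\<theta>. cis (real n * \<theta>) * cnj (g (rcis r \<theta>)))
      = 2 * pi * (cnj (b n) * of_real r ^ n)" for n
  proof -
    have "cnj (integral {0..2*pi} (\<lambda>\<theta>. g (rcis r \<theta>) * cis (- (real n * \<theta>)))) =
        integral {0..2*pi} (\<lambda>\<theta>. cis (real n * \<theta>) * cnj (g (rcis r \<theta>)))"
      by (simp add: integral_cnj cis_cnj mult.commute)
    then show ?thesis
      unfolding power_sums_coeff[OF g r] by simp
  qed
  with circle_integral_sums[OF f r g', THEN sums_divide, of "2*pi"]
  show ?thesis
    by (simp add: power2_eq_square power_mult_distrib algebra_simps)
qed

lemma circle_mean_sq_sums: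
  assumes f: "power_sums a f" and r: "0 \<le> r" "r < 1"
  shows "(\<lambda>n. (norm (a n))\<^sup>2 * (r\<^sup>2) ^ n) sums circle_mean_sq f r"
proof -
  have "integral {0..2*pi} (\<lambda>\<theta>. complex_of_real ((norm (f (rcis r \<theta>)))\<^sup>2)) =
     of_real (integral {0..2*pi} (\<lambda>\<theta>. (norm (f (rcis r \<theta>)))\<^sup>2))"
    using integral_linear[OF integrable_continuous_real bounded_linear_of_real,
        of 0 "2*pi" "\<lambda>\<theta>. (norm (f (rcis r \<theta>)))\<^sup>2"]
    by (simp add: o_def continuous_intros continuous_on_circle[OF power_sums_holomorphic[OF f] r])
  then have "(\<lambda>n. of_real ((norm (a n))\<^sup>2 * (r\<^sup>2) ^ n)) sums complex_of_real (circle_mean_sq f r)"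
    using parseval_circle[OF f f r] by (simp add: circle_mean_sq_def complex_norm_square[symmetric])
  then show ?thesis
    by (simp only: sums_of_real_iff)
qed

text \<open>Abel's limit in the absolutely convergent case: the series converges uniformly on the
  closed interval, so its sum is continuous up to 1. It evaluates the \<open>Lim\<close> in
  \<open>hardy_inner\<close>.\<close>

lemma abs_summable_tendsto_left_1:
  fixes c :: "nat \<Rightarrow> complex"
  assumes "summable (\<lambda>n. norm (c n))"
  shows "((\<lambda>r. \<Sum>n. c n * of_real (r\<^sup>2) ^ n) \<longlongrightarrow> (\<Sum>n. c n)) (at_left 1)"
proof -
  have "uniform_limit {0..1} (\<lambda>N r. \<Sum>n<N. c n * of_real (r\<^sup>2) ^ n)
      (\<lambda>r. \<Sum>n. c n * of_real ((r::real)\<^sup>2) ^ n) sequentially"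
  proof (rule Weierstrass_m_test[OF _ assms])
    fix n and r :: real assume "r \<in> {0..1}"
    then have "norm (complex_of_real (r\<^sup>2) ^ n) \<le> 1"
      by (simp add: norm_power power_le_one)
    then show "norm (c n * of_real (r\<^sup>2) ^ n) \<le> norm (c n)"
      unfolding norm_mult by (rule mult_left_le) simp
  qed
  then have "continuous_on {0..1} (\<lambda>r. \<Sum>n. c n * of_real ((r::real)\<^sup>2) ^ n)"
    by (rule uniform_limit_theorem[rotated]) (auto intro!: always_eventually continuous_intros)
  then have "((\<lambda>r. \<Sum>n. c n * of_real (r\<^sup>2) ^ n) \<longlongrightarrow> (\<Sum>n. c n)) (at 1 within {0..1::real})"
    by (auto simp: continuous_on_def dest: bspec[of _ _ 1])
  then show ?thesis
    by (simp add: at_within_Icc_at_left)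
qed

section \<open>The isometry from square summable sequences onto the Hardy space\<close>

definition to_hardy :: "ell2 \<Rightarrow> complex \<Rightarrow> complex" where
  "to_hardy x z = (if z \<in> ball 0 1 then \<Sum>n. coord x n * z ^ n else 0)"

text \<open>A total inverse, meaningful on the range of \<open>to_hardy\<close>, which turns out to
  be exactly \<open>hardy_space\<close>.\<close>

definition of_hardy :: "(complex \<Rightarrow> complex) \<Rightarrow> ell2" where
  "of_hardy = inv to_hardy"

lemma power_sums_to_hardy: "power_sums (coord x) (to_hardy x)"
  unfolding power_sums_def
proof
  fix z :: complex
  assume z: "z \<in> ball 0 1"
  have "summable (\<lambda>n. coord x n * z ^ n)"
  proof (rule summable_comparison_test')
    show "summable (\<lambda>n. norm x * norm z ^ n)"
      using z by (intro summable_mult summable_geometric) simp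
    show "norm (coord x n * z ^ n) \<le> norm x * norm z ^ n" for n
      by (simp add: norm_mult norm_power mult_right_mono norm_coord_le)
  qed
  then show "(\<lambda>n. coord x n * z ^ n) sums to_hardy x z"
    using z by (simp add: to_hardy_def summable_sums)
qed

lemma inj_to_hardy: "inj to_hardy"
  by (rule injI) (metis power_sums_to_hardy power_sums_unique coord_inject)

lemma of_hardy_to_hardy [simp]: "of_hardy (to_hardy x) = x"
  by (simp add: of_hardy_def inj_to_hardy)

lemma circle_mean_sq_le:
  assumes "0 \<le> r" "r < 1"
  shows "circle_mean_sq (to_hardy x) r \<le> (norm x)\<^sup>2"
  unfolding norm_ell2_power2
proof (rule sums_le[OF _ circle_mean_sq_sums[OF power_sums_to_hardy assms] summable_sums[OF summable_coord]])
  show "(norm (coord x n))\<^sup>2 * (r\<^sup>2) ^ n \<le> (norm (coord x n))\<^sup>2" for n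
    using assms by (intro mult_left_le) (auto simp: power_le_one)
qed

text \<open>Only finitely many coefficients are kept, so that the radius can tend to 1 term by term
  under the bound \<open>C\<close>.\<close>

lemma sum_coeff_le_circle_mean:
  assumes f: "power_sums a f" and C: "\<And>r. 0 \<le> r \<Longrightarrow> r < 1 \<Longrightarrow> circle_mean_sq f r \<le> C"
  shows "(\<Sum>n<N. (norm (a n))\<^sup>2) \<le> C"
proof (rule tendsto_upperbound)
  show "((\<lambda>r. \<Sum>n<N. (norm (a n))\<^sup>2 * (r\<^sup>2) ^ n) \<longlongrightarrow> (\<Sum>n<N. (norm (a n))\<^sup>2)) (at_left (1::real))"
    by (auto intro!: tendsto_eq_intros)
  have "(\<Sum>n<N. (norm (a n))\<^sup>2 * (r\<^sup>2) ^ n) \<le> C" if "0 < r" "r < 1" for r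
  proof -
    note s = circle_mean_sq_sums[OF f less_imp_le[OF that(1)] that(2)]
    have "(\<Sum>n<N. (norm (a n))\<^sup>2 * (r\<^sup>2) ^ n) \<le> circle_mean_sq f r"
      using sum_le_suminf[OF sums_summable[OF s], of "{..<N}"] sums_unique[OF s] by auto
    then show ?thesis
      using C[of r] that by simp
  qed
  then show "\<forall>\<^sub>F r in at_left (1::real). (\<Sum>n<N. (norm (a n))\<^sup>2 * (r\<^sup>2) ^ n) \<le> C"
    using eventually_at_left_real[of 0 1] by (auto elim: eventually_mono)
qed simp

lemma to_hardy_in_hardy: "to_hardy x \<in> hardy_space"
proof -
  have "bdd_above (circle_mean_sq (to_hardy x) ` {0..<1})"
    by (rule bdd_aboveI[of _ "(norm x)\<^sup>2"]) (auto intro: circle_mean_sq_le)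
  then show ?thesis
    using power_sums_holomorphic[OF power_sums_to_hardy] by (auto simp: hardy_space_def to_hardy_def)
qed

text \<open>This is surjectivity: bounded means make the Taylor coefficients at 0 square summable,
  and vanishing off the disc makes the two total functions equal everywhere.\<close>

lemma to_hardy_of_hardy [simp]:
  assumes "f \<in> hardy_space"
  shows "to_hardy (of_hardy f) = f"
proof -
  have f: "f holomorphic_on ball 0 1" "bdd_above (circle_mean_sq f ` {0..<1})"
    "\<And>z. z \<notin> ball 0 1 \<Longrightarrow> f z = 0"
    using assms by (auto simp: hardy_space_def)
  obtain C where "\<forall>r\<in>{0..<1}. circle_mean_sq f r \<le> C"
    using f(2) by (auto simp: bdd_above_def)
  then have "circle_mean_sq f r \<le> C" if "0 \<le> r" "r < 1" for r
    using that by simp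
  note fin = sum_coeff_le_circle_mean[OF holomorphic_power_sums[OF f(1)] this]
  have "summable (\<lambda>n. (norm ((deriv ^^ n) f 0 / fact n))\<^sup>2)"
    by (rule bounded_imp_summable[OF zero_le_power2]) (rule fin[of "Suc _", unfolded lessThan_Suc_atMost])
  then have "(\<lambda>n. (deriv ^^ n) f 0 / fact n) \<in> {a. summable (\<lambda>n. (norm (a n))\<^sup>2)}"
    unfolding mem_Collect_eq .
  then obtain x where x: "coord x = (\<lambda>n. (deriv ^^ n) f 0 / fact n)"
    by (rule coord_cases) (rule that, rule sym)
  have "to_hardy x = f"
  proof
    fix z
    show "to_hardy x z = f z"
      using power_sumsD[OF holomorphic_power_sums[OF f(1)], of z] f(3)[of z]
      by (auto simp: to_hardy_def x sums_unique[symmetric])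
  qed
  then show ?thesis
    using of_hardy_to_hardy by metis
qed

lemma hardy_norm_to_hardy [simp]: "hardy_norm (to_hardy x) = norm x"
proof -
  have bdd: "bdd_above (circle_mean_sq (to_hardy x) ` {0..<1})"
    using to_hardy_in_hardy[of x] by (simp add: hardy_space_def)
  have "(SUP r\<in>{0..<1}. circle_mean_sq (to_hardy x) r) = (norm x)\<^sup>2"
  proof (rule antisym)
    show "(SUP r\<in>{0..<1}. circle_mean_sq (to_hardy x) r) \<le> (norm x)\<^sup>2"
      by (rule cSUP_least) (auto intro: circle_mean_sq_le)
    show "(norm x)\<^sup>2 \<le> (SUP r\<in>{0..<1}. circle_mean_sq (to_hardy x) r)"
      unfolding norm_ell2_power2
      by (intro suminf_le_const summable_coord sum_coeff_le_circle_mean[OF power_sums_to_hardy]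
          cSUP_upper bdd) auto
  qed
  then show ?thesis
    by (simp add: hardy_norm_def)
qed

text \<open>The complex product is recovered from the real one: conjugate linearity in the second
  argument makes the real part of the product with \<open>i y\<close> the imaginary part of the
  product with \<open>y\<close>.\<close>

lemma hardy_inner_to_hardy:
  "hardy_inner (to_hardy x) (to_hardy y) = Complex (x \<bullet> y) (x \<bullet> mul_i y)"
proof -
  let ?c = "\<lambda>n. coord x n * cnj (coord y n)"
  let ?F = "\<lambda>r. integral {0..2*pi} (\<lambda>\<theta>. to_hardy x (rcis r \<theta>) * cnj (to_hardy y (rcis r \<theta>))) / (2*pi)"
  have abs: "summable (\<lambda>n. norm (?c n))"
    using summable_inner_square_summable(1)[OF summable_coord summable_coord] by (simp add: norm_mult)
  have "(?F \<longlongrightarrow> (\<Sum>n. ?c n)) (at_left 1)"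
  proof (rule Lim_transform_eventually[OF abs_summable_tendsto_left_1[OF abs]])
    have "(\<Sum>n. ?c n * of_real (r\<^sup>2) ^ n) = ?F r" if "r \<in> {0<..<1}" for r
      by (rule sums_unique[symmetric], rule parseval_circle)
         (use that in \<open>auto intro: power_sums_to_hardy\<close>)
    then show "\<forall>\<^sub>F r in at_left 1. (\<Sum>n. ?c n * of_real (r\<^sup>2) ^ n) = ?F r"
      using eventually_at_left_real[of 0 1] by (rule eventually_mono[rotated]) auto
  qed
  then have "hardy_inner (to_hardy x) (to_hardy y) = (\<Sum>n. ?c n)"
    unfolding hardy_inner_def by (intro tendsto_Lim) auto
  moreover have "?c sums Complex (x \<bullet> y) (x \<bullet> mul_i y)"
    unfolding sums_complex_iff
    using summable_sums[OF summable_inner_coord, of x y] summable_sums[OF summable_inner_coord, of x "mul_i y"]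
    by (simp add: inner_ell2_def coord_mul_i inner_complex_def algebra_simps)
  ultimately show ?thesis
    by (simp add: sums_unique[symmetric])
qed

lemma hardy_inner_eq:
  assumes "f \<in> hardy_space" "g \<in> hardy_space"
  shows "hardy_inner f g = Complex (of_hardy f \<bullet> of_hardy g) (of_hardy f \<bullet> mul_i (of_hardy g))"
  using hardy_inner_to_hardy[of "of_hardy f" "of_hardy g"] assms by simp

lemma hardy_norm_eq: "f \<in> hardy_space \<Longrightarrow> hardy_norm f = norm (of_hardy f)"
  using hardy_norm_to_hardy[of "of_hardy f"] by simp

lemma to_hardy_add: "to_hardy (x + y) = (\<lambda>z. to_hardy x z + to_hardy y z)"
proof
  fix z
  show "to_hardy (x + y) z = to_hardy x z + to_hardy y z"
  proof (cases "z \<in> ball 0 1")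
    case True
    then have z: "norm z < 1" by simp
    note sm = power_sumsD[OF power_sums_to_hardy z]
    show ?thesis
      using sums_add[OF sm[of x] sm[of y]] sm[of "x + y"]
      by (simp add: plus_ell2.rep_eq algebra_simps sums_unique2)
  qed (simp add: to_hardy_def)
qed

text \<open>The argument on the left is complex scalar multiplication by \<open>c\<close>, spelled
  with real scalars and \<open>mul_i\<close>.\<close>

lemma to_hardy_cmult: "to_hardy (Re c *\<^sub>R x + Im c *\<^sub>R mul_i x) = (\<lambda>z. c * to_hardy x z)"
proof
  fix z
  have c: "coord (Re c *\<^sub>R x + Im c *\<^sub>R mul_i x) n = c * coord x n" for n
    by (simp add: plus_ell2.rep_eq scaleR_ell2.rep_eq coord_mul_i complex_eq_iff)
  show "to_hardy (Re c *\<^sub>R x + Im c *\<^sub>R mul_i x) z = c * to_hardy x z"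
  proof (cases "z \<in> ball 0 1")
    case True
    then have z: "norm z < 1" by simp
    note sm = power_sumsD[OF power_sums_to_hardy z]
    show ?thesis
      using sums_mult[OF sm[of x], of c] sm[of "Re c *\<^sub>R x + Im c *\<^sub>R mul_i x"]
      by (simp add: c algebra_simps sums_unique2)
  qed (simp add: to_hardy_def)
qed

lemma hardy_space_add: "f \<in> hardy_space \<Longrightarrow> g \<in> hardy_space \<Longrightarrow> (\<lambda>z. f z + g z) \<in> hardy_space"
  and of_hardy_add:
    "f \<in> hardy_space \<Longrightarrow> g \<in> hardy_space \<Longrightarrow> of_hardy (\<lambda>z. f z + g z) = of_hardy f + of_hardy g"
  using to_hardy_add[of "of_hardy f" "of_hardy g"]
  by (simp_all, metis to_hardy_in_hardy, metis of_hardy_to_hardy)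

lemma hardy_space_cmult: "f \<in> hardy_space \<Longrightarrow> (\<lambda>z. c * f z) \<in> hardy_space"
  and of_hardy_cmult:
    "f \<in> hardy_space \<Longrightarrow> of_hardy (\<lambda>z. c * f z) = Re c *\<^sub>R of_hardy f + Im c *\<^sub>R mul_i (of_hardy f)"
  using to_hardy_cmult[of c "of_hardy f"]
  by (simp_all, metis to_hardy_in_hardy, metis of_hardy_to_hardy)

text \<open>Continuity of point evaluation, by comparison with a geometric series; it turns a norm
  convergent operator sum into pointwise convergence of functions.\<close>

lemma bounded_linear_to_hardy: "bounded_linear (\<lambda>x. to_hardy x z)"
proof (cases "z \<in> ball 0 1")
  case True
  then have z: "norm z < 1" by simp
  show ?thesis
  proof (rule bounded_linear_intro)
    fix x y :: ell2 and r :: real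
    show "to_hardy (x + y) z = to_hardy x z + to_hardy y z"
      by (simp add: to_hardy_add)
    show "to_hardy (r *\<^sub>R x) z = r *\<^sub>R to_hardy x z"
      using to_hardy_cmult[of "of_real r" x] by (simp add: scaleR_conv_of_real)
    show "norm (to_hardy x z) \<le> norm x * (1 / (1 - norm z))"
    proof (rule norm_sums_le[OF power_sumsD[OF power_sums_to_hardy z]])
      show "(\<lambda>n. norm x * norm z ^ n) sums (norm x * (1 / (1 - norm z)))"
        using z by (intro sums_mult geometric_sums) simp
      show "norm (coord x n * z ^ n) \<le> norm x * norm z ^ n" for n
        by (simp add: norm_mult norm_power mult_right_mono norm_coord_le)
    qed
  qed
qed (simp add: to_hardy_def)

section \<open>Trace class operators on the Hardy space\<close>

text \<open>Complex homogeneity comes from commutation with \<open>mul_i\<close>, and the norm bound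
  from \<open>norm L\<close> because \<open>to_hardy\<close> is isometric.\<close>

lemma bounded_operatorI:
  fixes L :: "ell2 \<Rightarrow>\<^sub>L ell2"
  assumes J: "\<And>x. L (mul_i x) = mul_i (L x)"
    and T: "\<And>f. f \<in> hardy_space \<Longrightarrow> T f = to_hardy (L (of_hardy f))"
  shows "bounded_operator T"
  unfolding bounded_operator_def
proof (intro conjI ballI allI exI)
  fix f g :: "complex \<Rightarrow> complex" and c :: complex
  assume f: "f \<in> hardy_space"
  show "T f \<in> hardy_space"
    by (simp add: T f to_hardy_in_hardy)
  show "hardy_norm (T f) \<le> norm L * hardy_norm f"
    by (simp add: T f hardy_norm_eq norm_blinfun)
  have "T (\<lambda>z. c * f z) = to_hardy (Re c *\<^sub>R L (of_hardy f) + Im c *\<^sub>R mul_i (L (of_hardy f)))"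
    by (simp add: T hardy_space_cmult of_hardy_cmult f blinfun.add_right blinfun.scaleR_right J)
  then show "T (\<lambda>z. c * f z) = (\<lambda>z. c * T f z)"
    by (simp add: T f to_hardy_cmult)
  assume g: "g \<in> hardy_space"
  show "T (\<lambda>z. f z + g z) = (\<lambda>z. T f z + T g z)"
    by (simp add: T hardy_space_add of_hardy_add f g blinfun.add_right to_hardy_add)
qed

text \<open>A pointwise expansion of \<open>T f\<close> suffices: evaluation at \<open>z\<close>
  identifies \<open>T\<close> with the operator built from the \<open>v n\<close>, and its adjoint
  and absolute value are carried over by \<open>to_hardy\<close>.\<close>

lemma trace_classI:
  fixes v :: "nat \<Rightarrow> ell2"
  assumes v: "summable (\<lambda>n. norm (v n))"
    and T: "\<And>f z. f \<in> hardy_space \<Longrightarrow>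
      (\<lambda>n. coord (of_hardy f) n * to_hardy (v n) z) sums T f z"
  shows "T \<in> trace_class"
proof -
  obtain L S A :: "ell2 \<Rightarrow>\<^sub>L ell2" where
    sL: "\<And>x. (\<lambda>n. rank_one mul_i (unit_vec n) (v n) x) sums L x"
    and adj: "\<And>x y. L x \<bullet> y = x \<bullet> S y" and AA: "\<And>x. A (A x) = S (L x)"
    and pos: "\<And>x. A x \<bullet> x \<ge> 0" and sa: "selfadjoint A"
    and LJ: "\<And>x. L (mul_i x) = mul_i (L x)" and SJ: "\<And>x. S (mul_i x) = mul_i (S x)"
    and AJ: "\<And>x. A (mul_i x) = mul_i (A x)"
    and tr: "\<And>E. \<forall>e\<in>E. \<forall>e'\<in>E. e \<bullet> e' = (if e = e' then 1 else 0) \<Longrightarrow> (\<lambda>e. A e \<bullet> e) summable_on E"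
    by (rule exists_trace_class_blinfun[OF v]) (rule that)
  have TL: "T f = to_hardy (L (of_hardy f))" if f: "f \<in> hardy_space" for f
  proof
    fix z
    let ?x = "of_hardy f"
    have "(\<lambda>n. to_hardy (rank_one mul_i (unit_vec n) (v n) ?x) z) sums to_hardy (L ?x) z"
      using bounded_linear.sums[OF bounded_linear_to_hardy sL] .
    moreover have "to_hardy (rank_one mul_i (unit_vec n) (v n) ?x) z = coord ?x n * to_hardy (v n) z" for n
      by (simp add: rank_one.rep_eq inner_unit_vec inner_mul_i_unit_vec to_hardy_cmult)
    ultimately show "T f z = to_hardy (L ?x) z"
      using T[OF f, of z] by (simp add: sums_unique2)
  qed
  define S' A' where "S' f = to_hardy (S (of_hardy f))" and "A' f = to_hardy (A (of_hardy f))" for f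
  have "bounded_operator T" "bounded_operator S'" "bounded_operator A'"
    using bounded_operatorI[OF LJ TL] bounded_operatorI[OF SJ, of S'] bounded_operatorI[OF AJ, of A']
    by (simp_all add: S'_def A'_def)
  moreover have "hardy_inner (T f) g = hardy_inner f (S' g)" if "f \<in> hardy_space" "g \<in> hardy_space" for f g
    using that by (simp add: hardy_inner_eq TL S'_def to_hardy_in_hardy adj SJ)
  ultimately have "is_adjoint S' T"
    by (simp add: is_adjoint_def)
  have inner_A: "hardy_inner (A' f) f = of_real (A (of_hardy f) \<bullet> of_hardy f)" if "f \<in> hardy_space" for f
  proof -
    let ?x = "of_hardy f"
    \<comment> \<open>The imaginary part of the product equals its own negative, as \<open>A\<close>
      is symmetric and commutes with the skew operator \<open>mul_i\<close>.\<close>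
    have "A ?x \<bullet> mul_i ?x = - (A ?x \<bullet> mul_i ?x)"
      using selfadjointD[OF sa, of ?x "mul_i ?x"] mul_i_skew[of "A ?x" ?x]
      by (simp add: AJ inner_commute)
    then show ?thesis
      using that by (simp add: hardy_inner_eq A'_def to_hardy_in_hardy complex_eq_iff)
  qed
  have "positive_operator A'"
    using \<open>bounded_operator A'\<close> pos by (simp add: positive_operator_def inner_A)
  moreover have "A' (A' f) = S' (T f)" if "f \<in> hardy_space" for f
    using that by (simp add: A'_def S'_def TL AA)
  ultimately have "is_abs_operator A' T"
    using \<open>is_adjoint S' T\<close> unfolding is_abs_operator_def by blast
  moreover have "(\<lambda>e. Re (hardy_inner (A' e) e)) summable_on B" if B: "orthonormal_basis B" for B
  proof -
    have BH: "B \<subseteq> hardy_space" and orth: "\<And>e e'. e \<in> B \<Longrightarrow> e' \<in> B \<Longrightarrow> hardy_inner e e' = (if e = e' then 1 else 0)"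
      using B by (auto simp: orthonormal_basis_def)
    \<comment> \<open>Injectivity serves twice: the case distinction \<open>e = e'\<close> carries
      over to the image of \<open>B\<close>, and the sum over that image can be reindexed by
      \<open>B\<close>.\<close>
    have inj: "inj_on of_hardy B"
      using BH by (intro inj_on_inverseI[of _ to_hardy]) auto
    have "of_hardy e \<bullet> of_hardy e' = (if of_hardy e = of_hardy e' then 1 else 0)"
      if "e \<in> B" "e' \<in> B" for e e'
    proof -
      have "of_hardy e \<bullet> of_hardy e' = Re (hardy_inner e e')"
        using that BH by (simp add: hardy_inner_eq subset_iff)
      then show ?thesis
        using orth[OF that] inj_on_eq_iff[OF inj that] by simp
    qed
    then have "(\<lambda>x. A x \<bullet> x) summable_on of_hardy ` B"
      by (intro tr) simp
    then have "(\<lambda>e. A (of_hardy e) \<bullet> of_hardy e) summable_on B"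
      using summable_on_reindex[OF inj, of "\<lambda>x. A x \<bullet> x"] by (simp add: o_def)
    also have "?this \<longleftrightarrow> ?thesis"
      using BH by (intro summable_on_cong) (auto simp: inner_A)
    finally show ?thesis .
  qed
  ultimately show ?thesis
    using \<open>bounded_operator T\<close> unfolding trace_class_def by blast
qed

section \<open>Bounded multipliers and the weighted composition operator\<close>

lemma mult_in_hardy_space:
  assumes h: "h \<in> hardy_space" and g: "g holomorphic_on ball 0 1"
    and bound: "\<And>z. z \<in> ball 0 1 \<Longrightarrow> norm (g z) \<le> M"
  shows "(\<lambda>z. h z * g z) \<in> hardy_space" "hardy_norm (\<lambda>z. h z * g z) \<le> hardy_norm h * M"
proof -
  have hh: "h holomorphic_on ball 0 1" "bdd_above (circle_mean_sq h ` {0..<1})"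
    and h0: "\<And>z. z \<notin> ball 0 1 \<Longrightarrow> h z = 0"
    using h by (auto simp: hardy_space_def)
  have M: "0 \<le> M"
    using order_trans[OF norm_ge_zero bound[of 0]] by simp
  have hg: "(\<lambda>z. h z * g z) holomorphic_on ball 0 1"
    by (intro holomorphic_intros hh g)
  have mean: "circle_mean_sq (\<lambda>z. h z * g z) r \<le> (hardy_norm h * M)\<^sup>2" if r: "r \<in> {0..<1}" for r
  proof -
    have int: "(\<lambda>\<theta>. (norm (f (rcis r \<theta>)))\<^sup>2) integrable_on {0..2*pi}"
      if "f holomorphic_on ball 0 1" for f :: "complex \<Rightarrow> complex"
      using r by (intro integrable_continuous_real continuous_intros continuous_on_circle that) auto
    have "integral {0..2*pi} (\<lambda>\<theta>. (norm (h (rcis r \<theta>) * g (rcis r \<theta>)))\<^sup>2)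
        \<le> integral {0..2*pi} (\<lambda>\<theta>. M\<^sup>2 * (norm (h (rcis r \<theta>)))\<^sup>2)"
    proof (rule integral_le)
      fix \<theta>
      have "norm (g (rcis r \<theta>)) \<le> M"
        using r by (intro bound) (simp add: norm_mult)
      then have "(norm (g (rcis r \<theta>)))\<^sup>2 \<le> M\<^sup>2"
        by (intro power_mono) auto
      then show "(norm (h (rcis r \<theta>) * g (rcis r \<theta>)))\<^sup>2 \<le> M\<^sup>2 * (norm (h (rcis r \<theta>)))\<^sup>2"
        by (simp add: norm_mult power_mult_distrib mult.commute mult_left_mono mult_right_mono)
    qed (auto intro!: integrable_on_mult_right int hh(1) simp: int[OF hg])
    then have "circle_mean_sq (\<lambda>z. h z * g z) r \<le> M\<^sup>2 * circle_mean_sq h r"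
      by (simp add: circle_mean_sq_def divide_right_mono)
    also have "circle_mean_sq h r \<le> (norm (of_hardy h))\<^sup>2"
      using circle_mean_sq_le[of r "of_hardy h"] r h by simp
    finally show ?thesis
      using M by (simp add: hardy_norm_eq[OF h] power_mult_distrib mult.commute mult_left_mono mult_right_mono)
  qed
  then have "bdd_above (circle_mean_sq (\<lambda>z. h z * g z) ` {0..<1})"
    by (intro bdd_aboveI[of _ "(hardy_norm h * M)\<^sup>2"]) auto
  then show "(\<lambda>z. h z * g z) \<in> hardy_space"
    using hg h0 by (auto simp: hardy_space_def)
  have "(SUP r\<in>{0..<1}. circle_mean_sq (\<lambda>z. h z * g z) r) \<le> (hardy_norm h * M)\<^sup>2"
    by (rule cSUP_least) (use mean in auto)
  then show "hardy_norm (\<lambda>z. h z * g z) \<le> hardy_norm h * M"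
    unfolding hardy_norm_def[of "\<lambda>z. h z * g z"]
    by (intro real_le_lsqrt) (simp_all add: hardy_norm_eq h M)
qed

theorem theorem2p8:
  fixes \<phi> h :: "complex \<Rightarrow> complex"
  assumes "\<phi> holomorphic_on ball 0 1"
    and "\<phi> ` ball 0 1 \<subseteq> ball 0 1"
    and "(SUP z\<in>ball 0 1. norm (\<phi> z)) < 1"
    and "h \<in> hardy_space"
  shows "weighted_composition h \<phi> \<in> trace_class"
proof -
  define \<rho> where "\<rho> = (SUP z\<in>ball 0 1. norm (\<phi> z))"
  \<comment> \<open>The supremum of reals bounds its members only for a set bounded above; the bound
    1 comes from \<open>\<phi>\<close> mapping into the disc.\<close>
  have "bdd_above ((\<lambda>z. norm (\<phi> z)) ` ball 0 1)"
    using assms(2) by (intro bdd_aboveI[of _ 1]) fastforce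
  then have \<phi>: "norm (\<phi> z) \<le> \<rho>" if "z \<in> ball 0 1" for z
    unfolding \<rho>_def using that by (rule cSUP_upper[rotated])
  have \<rho>: "0 \<le> \<rho>" "\<rho> < 1"
    using \<phi>[of 0] norm_ge_zero[of "\<phi> 0"] assms(3) by (auto simp: \<rho>_def[symmetric] simp del: norm_ge_zero)
  \<comment> \<open>These are the images of the monomials under the operator; the multiplier bound
    with \<open>g\<close> the n-th power of \<open>\<phi>\<close> makes their norms decay
    geometrically.\<close>
  define w where "w n z = h z * \<phi> z ^ n" for n z
  have w: "w n \<in> hardy_space" "hardy_norm (w n) \<le> hardy_norm h * \<rho> ^ n" for n
    using mult_in_hardy_space[OF assms(4), of "\<lambda>z. \<phi> z ^ n" "\<rho> ^ n"] \<phi>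
    by (auto simp: w_def[abs_def] norm_power power_mono intro!: holomorphic_intros assms(1))
  show ?thesis
  \<comment> \<open>The vectors \<open>v n\<close> are \<open>of_hardy (w n)\<close>, and the
    expansion is the power series of \<open>f\<close> evaluated at \<open>\<phi> z\<close> and
    multiplied by \<open>h z\<close>.\<close>
  proof (rule trace_classI)
    show "summable (\<lambda>n. norm (of_hardy (w n)))"
    proof (rule summable_comparison_test')
      show "summable (\<lambda>n. hardy_norm h * \<rho> ^ n)"
        using \<rho> by (intro summable_mult summable_geometric) simp
      show "norm (norm (of_hardy (w n))) \<le> hardy_norm h * \<rho> ^ n" for n
        using w[of n] by (simp add: hardy_norm_eq)
    qed
    fix f z assume f: "f \<in> hardy_space"
    have "(\<lambda>n. coord (of_hardy f) n * w n z) sums weighted_composition h \<phi> f z"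
    proof (cases "z \<in> ball 0 1")
      case True
      then have "norm (\<phi> z) < 1"
        using \<phi> \<rho> by fastforce
      from sums_mult[OF power_sumsD[OF power_sums_to_hardy this], of "h z" "of_hardy f"]
      show ?thesis
        using True f by (simp add: weighted_composition_def w_def mult.left_commute)
    next
      case False
      \<comment> \<open>Off the disc every \<open>w n z\<close> vanishes with \<open>h z\<close>,
        matching the default value 0 of \<open>weighted_composition\<close>.\<close>
      then have "h z = 0"
        using assms(4) by (simp add: hardy_space_def)
      then show ?thesis
        using False by (simp add: weighted_composition_def w_def)
    qed
    then show "(\<lambda>n. coord (of_hardy f) n * to_hardy (of_hardy (w n)) z) sums weighted_composition h \<phi> f z"
      using w by simp
  qed
qed

end
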